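(* Let $\mathcal{E}\subset\mathbb{R}^3$ be a prolate ellipsoid with center $O$ whose ratio between major and minor axis is greater than $2\sqrt{2}$. Then, in order that $O$ belongs to the $1$-hull of the union of pairwise non-overlapping closed (respectively, open) balls which do not contain $O$ and have their centers on $\mathcal{E}$, it is necessary and sufficient to have three balls. That is, for closed balls and likewise for open balls: (i) there exist three pairwise non-overlapping closed (respectively, open) balls with centers on $\mathcal{E}$, none of which contains $O$, such that $O$ belongs to the $1$-hull of their union; and (ii) for any collection of fewer than three pairwise non-overlapping closed (respectively, open) balls with centers on $\mathcal{E}$, none of which contains $O$, the point $O$ does not belong to the $1$-hull of their union.
   Context: A prolate ellipsoid in $\mathbb{R}^3$ is the surface which, in suitable Cartesian coordinates centered at its center $O$ and up to scaling, is given by $\frac{x_1^2}{d^2}+x_2^2+x_3^2=1$ with $d>1$; $d$ is the ratio of its major to its minor axis. Balls are Euclidean balls of positive radius in $\mathbb{R}^3$; the radii may differ. Non-overlapping means pairwise disjoint. A set $E\subset\mathbb{R}^n$ is $m$-convex relative to a point $x\in\mathbb{R}^n\setminus E$ if there exists an $m$-dimensional (affine) plane $L$ such that $x\in L$ and $L\cap E=\emptyset$. A set $E\subset\mathbb{R}^n$ is $m$-convex if it is $m$-convex relative to every point $x\in\mathbb{R}^n\setminus E$. Intersections of arbitrary families of $m$-convex sets are $m$-convex, and the $m$-hull of a set $E\subset\mathbb{R}^n$ is the minimal $m$-convex set containing $E$ (the intersection of all $m$-convex sets containing $E$). *)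

theory Defs
  imports "HOL-Analysis.Analysis"
begin

definition m_convex_rel :: "nat \<Rightarrow> 'a::euclidean_space set \<Rightarrow> 'a \<Rightarrow> bool" where
  "m_convex_rel m E x \<longleftrightarrow>
     x \<notin> E \<and> (\<exists>L. affine L \<and> aff_dim L = int m \<and> x \<in> L \<and> L \<inter> E = {})"

definition m_convex :: "nat \<Rightarrow> 'a::euclidean_space set \<Rightarrow> bool" where
  "m_convex m E \<longleftrightarrow> (\<forall>x. x \<notin> E \<longrightarrow> m_convex_rel m E x)"

definition m_hull :: "nat \<Rightarrow> 'a::euclidean_space set \<Rightarrow> 'a set" where
  "m_hull m E = m_convex m hull E"

text \<open>The Cartesian coordinates are centred at \<open>p\<close>; the isometric part is \<open>f\<close> and the scale
  is \<open>s\<close> (the length of the minor semi-axis). The surface itself is meant, not the solid.\<close>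

definition prolate_ellipsoid :: "real ^ 3 \<Rightarrow> real \<Rightarrow> (real ^ 3) set \<Rightarrow> bool" where
  "prolate_ellipsoid p d S \<longleftrightarrow> d > 1 \<and>
     (\<exists>(s :: real) (f :: real ^ 3 \<Rightarrow> real ^ 3). s > 0 \<and> orthogonal_transformation f \<and>
        S = (\<lambda>x :: real ^ 3. p + s *\<^sub>R f x) ` {x. (x $ 1)\<^sup>2 / d\<^sup>2 + (x $ 2)\<^sup>2 + (x $ 3)\<^sup>2 = 1})"

text \<open>The first argument is the ball former, \<open>cball\<close> or \<open>ball\<close>. Disjoint nonempty balls are distinct, so
  a collection of pairwise disjoint balls is faithfully represented by a set of balls.\<close>

definition admissible_balls ::
    "(real ^ 3 \<Rightarrow> real \<Rightarrow> (real ^ 3) set) \<Rightarrow> real ^ 3 \<Rightarrow> (real ^ 3) set \<Rightarrow> (real ^ 3) set set \<Rightarrow> bool" where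
  "admissible_balls bl p S \<B> \<longleftrightarrow>
     (\<forall>B\<in>\<B>. p \<notin> B \<and> (\<exists>c\<in>S. \<exists>r>0. B = bl c r)) \<and> pairwise disjnt \<B>"

end

theory Submission
  imports Defs
begin

text \<open>
  A point \<open>p\<close> lies in the 1-hull of a set exactly when every line through \<open>p\<close> meets the set
  (\<open>mem_m_hull_iff\<close>): a line that avoids the set has a 1-convex complement. So the question is
  which families of balls block every line through the centre of the ellipsoid.

  Two balls never do. A line through \<open>p\<close> orthogonal to both vectors from \<open>p\<close> to the centres
  has \<open>p\<close> as its nearest point to either centre, and \<open>p\<close> lies in neither ball
  (\<open>not_in_1_hull_of_few_balls\<close>).

  For three balls, let the ellipsoid have centre 0, minor semi-axis 1 and major semi-axis \<open>d\<close>
  along the first coordinate. Start from a degenerate position: a ball of radius nearly 1 about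
  \<open>e3\<close>, the third unit vector, blocks all lines except those close to the plane
  orthogonal to \<open>e3\<close>. A ball about the vertex \<open>(d, 0, 0)\<close> stays disjoint from unit
  balls about points of the equator \<open>x1 = 0\<close> of the ellipsoid if its radius is less
  than \<open>R = sqrt (d^2 + 1) - 1\<close>, and radius \<open>R\<close> is allowed next to smaller balls. It then blocks
  the lines whose angle with the major axis has sine less than \<open>R / d\<close>, and
  \<open>R^2 / d^2 = R / (R + 2)\<close> exceeds 1/2 precisely when \<open>R > 2\<close>, that is, when
  \<open>d > 2 sqrt 2\<close>. The remaining lines, close to the second axis, are left to a third ball of
  radius \<open>r3 < 1\<close> about \<open>(0, c, -s)\<close>, almost opposite to \<open>e3\<close>. Such a ball can only get near
  radius 1 as its centre tends to \<open>-e3\<close>, and then both what is allowed by disjointness from the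
  ball about \<open>e3\<close> and what is required for blocking tend to 1. Comparing the two to first order
  shows that there is room exactly if \<open>R / (R + 2) > 1/2\<close>; this is the content of
  \<open>tilted_cap_parameters\<close>. All the inequalities obtained are strict, so the same centres and
  radii serve for open and for closed balls.
\<close>

section \<open>Hulls and lines through a point\<close>

lemma mem_m_hull_iff:
  fixes x :: "'a::euclidean_space"
  shows "x \<in> m_hull m E \<longleftrightarrow>
    (\<forall>L. affine L \<and> aff_dim L = int m \<and> x \<in> L \<longrightarrow> L \<inter> E \<noteq> {})"
proof (intro iffI allI impI notI)
  fix L
  assume x: "x \<in> m_hull m E" and L: "affine L \<and> aff_dim L = int m \<and> x \<in> L" and LE: "L \<inter> E = {}"
  have "m_convex m (- L)"
    using L unfolding m_convex_def m_convex_rel_def by blast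
  moreover have "E \<subseteq> - L"
    using LE by blast
  ultimately have "m_hull m E \<subseteq> - L"
    unfolding m_hull_def by (simp add: hull_minimal)
  with x L show False by blast
next
  assume meets: "\<forall>L. affine L \<and> aff_dim L = int m \<and> x \<in> L \<longrightarrow> L \<inter> E \<noteq> {}"
  have "x \<in> K" if K: "m_convex m K" "E \<subseteq> K" for K
  proof (rule ccontr)
    assume "x \<notin> K"
    then obtain L where "affine L" "aff_dim L = int m" "x \<in> L" "L \<inter> K = {}"
      using K(1) unfolding m_convex_def m_convex_rel_def by meson
    with meets K(2) show False by blast
  qed
  then show "x \<in> m_hull m E"
    unfolding m_hull_def hull_def by simp
qed

lemma line_through_point:
  fixes p :: "'a::euclidean_space"
  assumes "affine L" "aff_dim L = 1" "p \<in> L"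
  obtains v where "norm v = 1" "\<And>t. p + t *\<^sub>R v \<in> L"
proof -
  have "L \<noteq> {p}"
    using assms(2) by auto
  then obtain q where q: "q \<in> L" "q \<noteq> p"
    using assms(3) by blast
  define v where "v = (1 / norm (q - p)) *\<^sub>R (q - p)"
  have "norm v = 1"
    using q by (simp add: v_def)
  moreover have "p + t *\<^sub>R v \<in> L" for t
  proof -
    have "(1 - t / norm (q - p)) *\<^sub>R p + (t / norm (q - p)) *\<^sub>R q \<in> L"
      using assms(1,3) q(1) by (simp add: affine_alt algebra_simps)
    then show ?thesis
      by (simp add: v_def algebra_simps)
  qed
  ultimately show ?thesis by (rule that)
qed

text \<open>Fewer vectors than the dimension have a common normal; moving from \<open>p\<close> along it brings
  no centre closer.\<close>

lemma not_in_1_hull_of_few_balls: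
  fixes p :: "'a::euclidean_space"
  assumes bl: "bl = ball \<or> bl = cball"
    and balls: "\<And>B. B \<in> \<B> \<Longrightarrow> p \<notin> B \<and> (\<exists>c r. B = bl c r)"
    and "finite \<B>" "card \<B> < DIM('a)"
  shows "p \<notin> m_hull 1 (\<Union>\<B>)"
proof -
  obtain c r where cr: "\<And>B. B \<in> \<B> \<Longrightarrow> B = bl (c B) (r B)"
    using balls by metis
  define V where "V = (\<lambda>B. c B - p) ` \<B>"
  have "dim V \<le> card V"
    unfolding V_def by (rule dim_le_card') (simp add: assms)
  also have "\<dots> \<le> card \<B>"
    unfolding V_def by (rule card_image_le) (rule assms)
  finally have "dim V < DIM('a)"
    using assms by linarith
  then obtain v where v: "v \<noteq> 0" "\<And>y. y \<in> span V \<Longrightarrow> orthogonal v y"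
    using orthogonal_to_subspace_exists by metis
  define L where "L = affine hull {p, p + v}"
  have "L \<inter> \<Union>\<B> = {}"
  proof (rule ccontr)
    assume "L \<inter> \<Union>\<B> \<noteq> {}"
    then obtain x B where x: "x \<in> L" "B \<in> \<B>" "x \<in> B" by blast
    obtain a b where "a + b = 1" "x = a *\<^sub>R p + b *\<^sub>R (p + v)"
      using x(1) unfolding L_def affine_hull_2 by blast
    then have xb: "x = p + b *\<^sub>R v"
      by (metis add.assoc scaleR_add_left scaleR_add_right scaleR_one)
    have "c B - p \<in> span V"
      using x(2) by (auto simp: V_def intro: span_base)
    then have "orthogonal (c B - p) (b *\<^sub>R v)"
      using v(2)[of "c B - p"] by (simp add: orthogonal_def inner_commute)
    then have "(norm (c B - p - b *\<^sub>R v))\<^sup>2 = (norm (c B - p))\<^sup>2 + (norm (b *\<^sub>R v))\<^sup>2"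
      using norm_add_Pythagorean[of "c B - p" "- (b *\<^sub>R v)"]
      by (simp add: orthogonal_clauses)
    then have "(norm (c B - p))\<^sup>2 \<le> (norm (c B - p - b *\<^sub>R v))\<^sup>2"
      by (metis le_add_same_cancel1 zero_le_power2)
    then have "norm (c B - p) \<le> norm (c B - p - b *\<^sub>R v)"
      by (rule power2_le_imp_le) (rule norm_ge_zero)
    then have "dist (c B) p \<le> dist (c B) x"
      by (simp only: dist_norm xb diff_diff_eq)
    moreover have "p \<notin> bl (c B) (r B)" "x \<in> bl (c B) (r B)"
      using balls cr x by metis+
    ultimately show False
      using bl by auto
  qed
  moreover have "affine L" "p \<in> L" "aff_dim L = 1"
    using v(1) by (auto simp: L_def hull_inc aff_dim_2)
  ultimately show ?thesis
    unfolding mem_m_hull_iff by auto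
qed

section \<open>Three balls blocking every line\<close>

text \<open>The third ball. The equation \<open>2 + 2 s = (1 + r3)^2\<close> says that \<open>(0, c, -s)\<close> is at distance
  \<open>1 + r3\<close> from \<open>(0, 0, 1)\<close>; the inequality says that the ball meets every line through 0 in the
  plane \<open>z = 0\<close> that the ball at the vertex leaves unblocked. With \<open>r3 = 1 - t\<close> both sides of the
  inequality vanish at \<open>t = 0\<close>, with slopes 2 and \<open>4 K\<close> where \<open>K = R / (R + 2) > 1/2\<close>, so it holds
  for small \<open>t\<close>.\<close>

lemma tilted_cap_parameters:
  fixes R :: real
  assumes "R > 2"
  obtains r3 s c :: real where "0 < r3" "r3 < 1" "0 < c" "s\<^sup>2 + c\<^sup>2 = 1" "2 + 2 * s = (1 + r3)\<^sup>2"
    "1 - r3\<^sup>2 < (R / (R + 2)) * c\<^sup>2" "0 < s"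
proof -
  define K where "K = R / (R + 2)"
  have K: "1 / 2 < K" "K < 1"
    using assms by (simp_all add: K_def field_simps)
  \<comment> \<open>After division by \<open>t\<close> the claim follows from \<open>2 - t < K * (4 - 5 * t)\<close>, which this \<open>t\<close> satisfies.\<close>
  define t where "t = K - 1 / 2"
  have t: "0 < t" "t < 1 / 2"
    using K by (auto simp: t_def)
  \<comment> \<open>\<open>\<sigma> = 1 - s\<close>, obtained by solving \<open>2 + 2 * s = (2 - t)\<^sup>2\<close>.\<close>
  define \<sigma> where "\<sigma> = t * (2 - t / 2)"
  have \<sigma>: "0 < \<sigma>" "\<sigma> < 1"
  proof -
    show "0 < \<sigma>"
      using t by (simp add: \<sigma>_def)
    have "1 - \<sigma> = (1 - t) * (1 - t) - t\<^sup>2 / 2"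
      by (simp add: \<sigma>_def power2_eq_square algebra_simps)
    moreover have "t\<^sup>2 < (1 - t)\<^sup>2"
      using t by (intro power_strict_mono) auto
    ultimately show "\<sigma> < 1"
      using zero_le_power2[of t] unfolding power2_eq_square by linarith
  qed
  define s where "s = 1 - \<sigma>"
  have s: "0 < s" "s < 1"
    using \<sigma> by (auto simp: s_def)
  have s2: "s\<^sup>2 < 1"
    using s by (simp add: power_less_one_iff)
  define c where "c = sqrt (1 - s\<^sup>2)"
  have c2: "c\<^sup>2 = \<sigma> * (2 - \<sigma>)"
  proof -
    have "c\<^sup>2 = 1 - s\<^sup>2"
      using s2 by (simp add: c_def)
    also have "\<dots> = \<sigma> * (2 - \<sigma>)"
      by (simp add: s_def power2_eq_square algebra_simps)
    finally show ?thesis .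
  qed
  show ?thesis
  proof (rule that[of "1 - t" c s])
    show "0 < 1 - t" "1 - t < 1" "0 < s" using t s by auto
    show "0 < c" using s2 by (simp add: c_def)
    show "s\<^sup>2 + c\<^sup>2 = 1" using s2 by (simp add: c_def)
    show "2 + 2 * s = (1 + (1 - t))\<^sup>2"
      by (simp add: s_def \<sigma>_def power2_eq_square algebra_simps)
    have "2 - t < K * (4 - 5 * t)"
    proof -
      have "t * t < t * (1 / 2)"
        using t by (intro mult_strict_left_mono)
      then show ?thesis
        using t(1) by (simp add: t_def algebra_simps)
    qed
    also have "\<dots> \<le> K * ((2 - t / 2) * (2 - \<sigma>))"
    proof (rule mult_left_mono)
      have "(2 - t / 2) * (2 - \<sigma>) = 4 - 5 * t + t\<^sup>2 * (2 - t / 4)"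
        by (simp add: \<sigma>_def power2_eq_square algebra_simps)
      then show "4 - 5 * t \<le> (2 - t / 2) * (2 - \<sigma>)"
        using t by simp
    qed (use K in simp)
    finally have "t * (2 - t) < t * (K * ((2 - t / 2) * (2 - \<sigma>)))"
      by (rule mult_strict_left_mono) (rule t)
    moreover have "1 - (1 - t)\<^sup>2 = t * (2 - t)"
      by (simp add: power2_eq_square algebra_simps)
    moreover have "K * c\<^sup>2 = t * (K * ((2 - t / 2) * (2 - \<sigma>)))"
      unfolding c2 by (simp add: \<sigma>_def)
    ultimately show "1 - (1 - t)\<^sup>2 < R / (R + 2) * c\<^sup>2"
      unfolding K_def by linarith
  qed
qed

text \<open>The lines as unit vectors \<open>(x, y, z)\<close>. In the limit where the second ball has radius 1 only
  \<open>z = 0\<close> is left by it, and there the hypothesis on \<open>r3\<close> is what the third ball needs. The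
  hypothesis is strict, so it survives a thin strip \<open>\<bar>z\<bar> \<le> h\<close>.\<close>

lemma three_caps_cover:
  fixes R r3 s c :: real
  assumes R: "R > 2" and c: "0 < c" and s: "0 < s"
    and r3: "1 - r3\<^sup>2 < (R / (R + 2)) * c\<^sup>2"
  obtains r2 where "0 < r2" "r2 < 1"
    "\<And>x y z :: real. x\<^sup>2 + y\<^sup>2 + z\<^sup>2 = 1 \<Longrightarrow>
       1 - x\<^sup>2 < R / (R + 2) \<or> 1 - z\<^sup>2 < r2\<^sup>2 \<or> 1 - (c * y - s * z)\<^sup>2 < r3\<^sup>2"
proof -
  define K where "K = R / (R + 2)"
  have K: "1 / 2 < K" "K < 1"
    using assms by (simp_all add: K_def field_simps)
  have "((\<lambda>h. c * sqrt (K - h\<^sup>2) - s * h) \<longlongrightarrow> c * sqrt (K - 0\<^sup>2) - s * 0) (at_right 0)"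
    by (intro tendsto_intros)
  moreover have "sqrt (1 - r3\<^sup>2) < c * sqrt K"
  proof -
    have "sqrt (1 - r3\<^sup>2) < sqrt (K * c\<^sup>2)"
      using r3 by (simp add: K_def)
    also have "\<dots> = c * sqrt K"
      using c by (simp add: real_sqrt_mult)
    finally show ?thesis .
  qed
  ultimately have "eventually (\<lambda>h. sqrt (1 - r3\<^sup>2) < c * sqrt (K - h\<^sup>2) - s * h) (at_right 0)"
    by (intro order_tendstoD(1)) auto
  moreover have "eventually (\<lambda>h::real. h < 1/2) (at_right 0)" "eventually (\<lambda>h::real. 0 < h) (at_right 0)"
    by (auto simp: eventually_at_right_field intro!: exI[of _ "1/2"])
  ultimately have "eventually (\<lambda>h. sqrt (1 - r3\<^sup>2) < c * sqrt (K - h\<^sup>2) - s * h \<and> h < 1/2 \<and> 0 < h) (at_right 0)"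
    by eventually_elim auto
  then obtain h where h: "sqrt (1 - r3\<^sup>2) < c * sqrt (K - h\<^sup>2) - s * h" "h < 1/2" "0 < h"
    using eventually_happens'[OF trivial_limit_at_right_real] by blast
  have h2: "h\<^sup>2 < 1 / 4"
    using power_strict_mono[OF h(2), of 2] h(3) by (simp add: power2_eq_square)
  show ?thesis
  proof (rule that[of "sqrt (1 - h\<^sup>2)"])
    show "0 < sqrt (1 - h\<^sup>2)" "sqrt (1 - h\<^sup>2) < 1"
      using h2 h(3) by auto
    fix x y z :: real
    assume u: "x\<^sup>2 + y\<^sup>2 + z\<^sup>2 = 1"
    show "1 - x\<^sup>2 < R / (R + 2) \<or> 1 - z\<^sup>2 < (sqrt (1 - h\<^sup>2))\<^sup>2 \<or> 1 - (c * y - s * z)\<^sup>2 < r3\<^sup>2"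
    proof (rule ccontr)
      assume "\<not> ?thesis"
      then have n: "K \<le> 1 - x\<^sup>2" "z\<^sup>2 \<le> h\<^sup>2" "(c * y - s * z)\<^sup>2 \<le> 1 - r3\<^sup>2"
        using h2 by (auto simp: K_def)
      have z: "\<bar>z\<bar> \<le> h"
        using n(2) h(3) by (simp add: abs_le_square_iff[symmetric])
      have "K - h\<^sup>2 \<le> y\<^sup>2"
        using n u by linarith
      then have y: "sqrt (K - h\<^sup>2) \<le> \<bar>y\<bar>"
        using real_sqrt_le_mono by fastforce
      have "c * sqrt (K - h\<^sup>2) - s * h \<le> c * \<bar>y\<bar> - s * \<bar>z\<bar>"
        using y z c s by (intro diff_mono mult_left_mono) auto
      also have "\<dots> = \<bar>c * y\<bar> - \<bar>s * z\<bar>"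
        using c s by (simp add: abs_mult)
      also have "\<dots> \<le> \<bar>c * y - s * z\<bar>"
        by (rule abs_triangle_ineq2)
      also have "\<dots> \<le> sqrt (1 - r3\<^sup>2)"
        using real_sqrt_le_mono[OF n(3)] by simp
      finally show False
        using h(1) by simp
    qed
  qed
qed

text \<open>The quantity \<open>(norm c)\<^sup>2 - (c \<bullet> u)\<^sup>2\<close> is the squared distance from \<open>c\<close> to the line through 0
  with unit direction \<open>u\<close>.\<close>

definition hits_every_line :: "'a::real_inner \<Rightarrow> real \<Rightarrow> 'a \<Rightarrow> real \<Rightarrow> 'a \<Rightarrow> real \<Rightarrow> bool" where
  "hits_every_line c1 r1 c2 r2 c3 r3 \<longleftrightarrow>
     (\<forall>u. norm u = 1 \<longrightarrow> (norm c1)\<^sup>2 - (c1 \<bullet> u)\<^sup>2 < r1\<^sup>2 \<or>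
        (norm c2)\<^sup>2 - (c2 \<bullet> u)\<^sup>2 < r2\<^sup>2 \<or> (norm c3)\<^sup>2 - (c3 \<bullet> u)\<^sup>2 < r3\<^sup>2)"

lemma three_balls_in_standard_position:
  fixes d :: real
  assumes d: "d > 2 * sqrt 2"
  obtains c1 c2 c3 :: "real ^ 3" and r1 r2 r3 :: real
  where "\<And>c. c \<in> {c1, c2, c3} \<Longrightarrow> (c $ 1)\<^sup>2 / d\<^sup>2 + (c $ 2)\<^sup>2 + (c $ 3)\<^sup>2 = 1"
    "0 < r1" "r1 < norm c1" "0 < r2" "r2 < norm c2" "0 < r3" "r3 < norm c3"
    "r1 + r2 < dist c1 c2" "r1 + r3 < dist c1 c3" "r2 + r3 < dist c2 c3"
    "hits_every_line c1 r1 c2 r2 c3 r3"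
proof -
  have d0: "0 < d"
    using d by (smt (verit) real_sqrt_gt_zero)
  have d8: "8 < d\<^sup>2"
    using power_strict_mono[OF d, of 2] by (simp add: power_mult_distrib)
  define R where "R = sqrt (d\<^sup>2 + 1) - 1"
  have "sqrt 9 < sqrt (d\<^sup>2 + 1)"
    using d8 by (intro real_sqrt_less_mono) simp
  then have R: "R > 2"
    by (simp add: R_def)
  have dR: "d\<^sup>2 = R * (R + 2)"
    by (simp add: R_def algebra_simps power2_eq_square[symmetric])
  have Rd: "R < d"
  proof (rule power_less_imp_less_base)
    show "R\<^sup>2 < d\<^sup>2"
      unfolding dR using R by (simp add: power2_eq_square)
  qed (use d0 in simp)
  obtain r3 s c where p: "0 < r3" "r3 < 1" "0 < c" "s\<^sup>2 + c\<^sup>2 = 1" "2 + 2 * s = (1 + r3)\<^sup>2"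
    "1 - r3\<^sup>2 < (R / (R + 2)) * c\<^sup>2" "0 < s"
    using tilted_cap_parameters[OF R] by metis
  obtain r2 where r2: "0 < r2" "r2 < 1"
    and cov: "\<And>x y z :: real. x\<^sup>2 + y\<^sup>2 + z\<^sup>2 = 1 \<Longrightarrow>
       1 - x\<^sup>2 < R / (R + 2) \<or> 1 - z\<^sup>2 < r2\<^sup>2 \<or> 1 - (c * y - s * z)\<^sup>2 < r3\<^sup>2"
    using three_caps_cover[OF R p(3,7,6)] by metis
  define c1 c2 c3 :: "real ^ 3" where "c1 = vector [d, 0, 0]" and "c2 = vector [0, 0, 1]"
    and "c3 = vector [0, c, - s]"
  note cs = c1_def c2_def c3_def
  have n3: "norm v = sqrt ((v $ 1)\<^sup>2 + (v $ 2)\<^sup>2 + (v $ 3)\<^sup>2)" for v :: "real ^ 3"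
    by (simp add: norm_vec_def L2_set_def sum_3)
  have nc: "norm c1 = d" "norm c2 = 1" "norm c3 = 1"
    using d0 p(4) by (simp_all add: n3 cs add.commute)
  have D: "dist c1 c2 = R + 1" "dist c1 c3 = R + 1" "dist c2 c3 = 1 + r3"
  proof -
    have sc: "c\<^sup>2 + s\<^sup>2 = 1"
      using p(4) by simp
    show "dist c1 c2 = R + 1" "dist c1 c3 = R + 1"
      using sc by (simp_all add: dist_norm n3 cs R_def add.assoc)
    have "c\<^sup>2 + (1 + s)\<^sup>2 = (s\<^sup>2 + c\<^sup>2) + 1 + 2 * s"
      by (simp add: power2_eq_square algebra_simps)
    then have "c\<^sup>2 + (1 + s)\<^sup>2 = (1 + r3)\<^sup>2"
      unfolding p(4) p(5)[symmetric] by simp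
    then show "dist c2 c3 = 1 + r3"
      using p(1) by (simp add: dist_norm n3 cs)
  qed
  show ?thesis
  proof (rule that[of c1 c2 c3 R r2 r3])
    show "(v $ 1)\<^sup>2 / d\<^sup>2 + (v $ 2)\<^sup>2 + (v $ 3)\<^sup>2 = 1" if "v \<in> {c1, c2, c3}" for v
      using that d0 p(4) by (auto simp: cs add.commute)
    show "hits_every_line c1 R c2 r2 c3 r3"
      unfolding hits_every_line_def
    proof (intro allI impI)
      fix u :: "real ^ 3"
      assume "norm u = 1"
      then have u: "(u $ 1)\<^sup>2 + (u $ 2)\<^sup>2 + (u $ 3)\<^sup>2 = 1"
        by (simp add: n3)
      have in': "c1 \<bullet> u = d * u $ 1" "c2 \<bullet> u = u $ 3" "c3 \<bullet> u = c * u $ 2 - s * u $ 3"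
        by (simp_all add: inner_vec_def sum_3 cs)
      have "d\<^sup>2 - (d * u $ 1)\<^sup>2 < R\<^sup>2" if "1 - (u $ 1)\<^sup>2 < R / (R + 2)"
      proof -
        have "d\<^sup>2 * (1 - (u $ 1)\<^sup>2) < d\<^sup>2 * (R / (R + 2))"
          by (rule mult_strict_left_mono[OF that]) (use d0 in simp)
        also have "\<dots> = R\<^sup>2"
          using R unfolding dR by (simp add: power2_eq_square)
        finally show ?thesis
          by (simp add: power_mult_distrib algebra_simps)
      qed
      then show "(norm c1)\<^sup>2 - (c1 \<bullet> u)\<^sup>2 < R\<^sup>2 \<or> (norm c2)\<^sup>2 - (c2 \<bullet> u)\<^sup>2 < r2\<^sup>2 \<or>
          (norm c3)\<^sup>2 - (c3 \<bullet> u)\<^sup>2 < r3\<^sup>2"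
        using cov[OF u] by (auto simp: in' nc)
    qed
  qed (use R Rd p r2 nc D in auto)
qed

lemma line_meets_ball:
  fixes c u :: "'a::real_inner"
  assumes "norm u = 1" "(norm c)\<^sup>2 - (c \<bullet> u)\<^sup>2 < r\<^sup>2" "0 < r"
  shows "dist c ((c \<bullet> u) *\<^sub>R u) < r"
proof -
  have "u \<bullet> u = 1"
    using assms(1) by (simp add: dot_square_norm)
  then have "(dist c ((c \<bullet> u) *\<^sub>R u))\<^sup>2 = (norm c)\<^sup>2 - (c \<bullet> u)\<^sup>2"
    unfolding dist_norm power2_norm_eq_inner
    by (simp add: inner_diff_left inner_diff_right inner_commute[of u c] power2_eq_square)
  then show ?thesis
    using assms(2,3) by (intro power_less_imp_less_base[of _ 2 r]) simp_all
qed

section \<open>Transfer to an arbitrary prolate ellipsoid\<close>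

text \<open>The configuration in standard position is carried over by the similarity
  \<open>x \<mapsto> p + k f(x)\<close> that produces the ellipsoid. Since its inequalities are strict, it suffices that
  each ball, of either kind, lies between the open and the closed ball of the same radius.\<close>

lemma three_balls_on_ellipsoid:
  fixes p :: "real ^ 3"
  assumes bl: "bl = ball \<or> bl = cball"
    and "prolate_ellipsoid p d S" and d: "d > 2 * sqrt 2"
  shows "\<exists>\<B>. admissible_balls bl p S \<B> \<and> card \<B> = 3 \<and> p \<in> m_hull 1 (\<Union>\<B>)"
proof -
  obtain k and f :: "real ^ 3 \<Rightarrow> real ^ 3" where k: "k > 0" and f: "orthogonal_transformation f"
    and S: "S = (\<lambda>x. p + k *\<^sub>R f x) ` {x. (x $ 1)\<^sup>2 / d\<^sup>2 + (x $ 2)\<^sup>2 + (x $ 3)\<^sup>2 = 1}"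
    using assms(2) unfolding prolate_ellipsoid_def by blast
  obtain c1 c2 c3 :: "real ^ 3" and r1 r2 r3 :: real
    where c: "\<And>c. c \<in> {c1, c2, c3} \<Longrightarrow> (c $ 1)\<^sup>2 / d\<^sup>2 + (c $ 2)\<^sup>2 + (c $ 3)\<^sup>2 = 1"
    and r: "0 < r1" "r1 < norm c1" "0 < r2" "r2 < norm c2" "0 < r3" "r3 < norm c3"
    and dj: "r1 + r2 < dist c1 c2" "r1 + r3 < dist c1 c3" "r2 + r3 < dist c2 c3"
    and hit: "hits_every_line c1 r1 c2 r2 c3 r3"
    by (rule three_balls_in_standard_position[OF d]) blast
  define g where "g x = p + k *\<^sub>R f x" for x
  have lin: "linear f"
    using f by (rule orthogonal_transformation_linear)
  have g: "dist (g x) (g y) = k * dist x y" for x y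
  proof -
    have "g x - g y = k *\<^sub>R f (x - y)"
      by (simp add: g_def linear_diff[OF lin] scaleR_diff_right)
    then show ?thesis
      using k by (simp add: dist_norm orthogonal_transformation_norm[OF f])
  qed
  have g0: "g 0 = p"
    by (simp add: g_def linear_0[OF lin])
  define b where "b c r = bl (g c) (k * r)" for c r
  have sub: "ball c r \<subseteq> bl c r" "bl c r \<subseteq> cball c r" for c r
    using bl by auto
  have disj: "disjnt (b c r) (b c' r')" if "r + r' < dist c c'" for c r c' r'
  proof -
    have "k * r + k * r' < dist (g c) (g c')"
      using that k by (simp add: g distrib_left[symmetric])
    then have "disjnt (cball (g c) (k * r)) (cball (g c') (k * r'))"
      by (auto simp: disjnt_iff) (smt (verit) dist_triangle2 dist_commute)
    then show ?thesis
      unfolding b_def using sub by (meson disjnt_subset1 disjnt_subset2)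
  qed
  have adm: "p \<notin> b c r \<and> (\<exists>C\<in>S. \<exists>q>0. b c r = bl C q)"
    if "c \<in> {c1, c2, c3}" "0 < r" "r < norm c" for c r
  proof (intro conjI)
    have "k * r < dist (g c) (g 0)"
      unfolding g using that k by simp
    then have "k * r < dist (g c) p"
      by (simp only: g0)
    then show "p \<notin> b c r"
      using sub(2)[of "g c" "k * r"] unfolding b_def by auto
    have "g c \<in> S"
      unfolding S g_def using assms c[OF that(1)] by blast
    then show "\<exists>C\<in>S. \<exists>q>0. b c r = bl C q"
      unfolding b_def using that(2) k
      by (intro bexI[of _ "g c"] exI[of _ "k * r"]) simp_all
  qed
  have ne: "b c r \<noteq> {}" if "0 < r" for c r
    using sub(1)[of "g c" "k * r"] that k unfolding b_def by (metis ball_eq_empty mult_pos_pos not_le subset_empty)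
  define \<B> where "\<B> = {b c1 r1, b c2 r2, b c3 r3}"
  have ds: "disjnt (b c1 r1) (b c2 r2)" "disjnt (b c1 r1) (b c3 r3)" "disjnt (b c2 r2) (b c3 r3)"
    using disj dj by auto
  have "admissible_balls bl p S \<B>"
    unfolding admissible_balls_def
  proof
    show "pairwise disjnt \<B>"
      unfolding \<B>_def pairwise_def using ds ds[THEN disjnt_sym] by blast
    have "p \<notin> b c1 r1 \<and> (\<exists>C\<in>S. \<exists>q>0. b c1 r1 = bl C q)" "p \<notin> b c2 r2 \<and> (\<exists>C\<in>S. \<exists>q>0. b c2 r2 = bl C q)"
      "p \<notin> b c3 r3 \<and> (\<exists>C\<in>S. \<exists>q>0. b c3 r3 = bl C q)"
      by (rule adm; use r in simp)+
    then show "\<forall>B\<in>\<B>. p \<notin> B \<and> (\<exists>C\<in>S. \<exists>q>0. B = bl C q)"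
      unfolding \<B>_def by blast
  qed
  moreover have "card \<B> = 3"
  proof -
    have "b c1 r1 \<noteq> b c2 r2" "b c1 r1 \<noteq> b c3 r3" "b c2 r2 \<noteq> b c3 r3"
      using ds ne r by (metis disjnt_self_iff_empty)+
    then show ?thesis
      by (simp add: \<B>_def)
  qed
  moreover have "p \<in> m_hull 1 (\<Union>\<B>)"
    unfolding mem_m_hull_iff
  proof (intro allI impI)
    fix L :: "(real ^ 3) set"
    assume "affine L \<and> aff_dim L = int 1 \<and> p \<in> L"
    then obtain v where v: "norm v = 1" "\<And>t. p + t *\<^sub>R v \<in> L"
      using line_through_point[of L p] by auto
    obtain u where u: "f u = v"
      using orthogonal_transformation_surj[OF f] by (metis surjD)
    have nu: "norm u = 1"
      using v(1) orthogonal_transformation_norm[OF f, of u] by (simp add: u)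
    have on_line: "g (t *\<^sub>R u) \<in> L" for t
      using v(2)[of "k * t"] by (simp add: g_def linear_scale[OF lin] u)
    have "L \<inter> b c r \<noteq> {}" if "(norm c)\<^sup>2 - (c \<bullet> u)\<^sup>2 < r\<^sup>2" "0 < r" for c r
    proof -
      have "dist (g c) (g ((c \<bullet> u) *\<^sub>R u)) < k * r"
        using line_meets_ball[OF nu that] k by (simp add: g)
      then have "g ((c \<bullet> u) *\<^sub>R u) \<in> b c r"
        unfolding b_def by (intro subsetD[OF sub(1)]) simp
      then show ?thesis
        using on_line by blast
    qed
    then show "L \<inter> \<Union>\<B> \<noteq> {}"
      using hit[unfolded hits_every_line_def, rule_format, OF nu] r by (auto simp: \<B>_def Int_Un_distrib)
  qed
  ultimately show ?thesis by blast
qed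

theorem theorem1:
  fixes p :: "real ^ 3" and d :: real and S :: "(real ^ 3) set"
  assumes "prolate_ellipsoid p d S" and "d > 2 * sqrt 2"
  shows "((\<exists>\<B>. admissible_balls cball p S \<B> \<and> card \<B> = 3 \<and> p \<in> m_hull 1 (\<Union>\<B>)) \<and>
          (\<forall>\<B>. admissible_balls cball p S \<B> \<and> finite \<B> \<and> card \<B> < 3
                \<longrightarrow> p \<notin> m_hull 1 (\<Union>\<B>))) \<and>
         ((\<exists>\<B>. admissible_balls ball p S \<B> \<and> card \<B> = 3 \<and> p \<in> m_hull 1 (\<Union>\<B>)) \<and>
          (\<forall>\<B>. admissible_balls ball p S \<B> \<and> finite \<B> \<and> card \<B> < 3
                \<longrightarrow> p \<notin> m_hull 1 (\<Union>\<B>)))"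
proof -
  have few: "p \<notin> m_hull 1 (\<Union>\<B>)"
    if "bl = ball \<or> bl = cball" "admissible_balls bl p S \<B>" "finite \<B>" "card \<B> < 3" for bl \<B>
  proof (rule not_in_1_hull_of_few_balls[OF that(1) _ that(3)])
    show "p \<notin> B \<and> (\<exists>c r. B = bl c r)" if "B \<in> \<B>" for B
      using \<open>admissible_balls bl p S \<B>\<close> that unfolding admissible_balls_def by blast
    show "card \<B> < DIM(real ^ 3)"
      using that(4) by simp
  qed
  show ?thesis
    using three_balls_on_ellipsoid[of cball, OF _ assms] three_balls_on_ellipsoid[of ball, OF _ assms]
      few[of cball] few[of ball]
    by simp
qed

end
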